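(* Let $k\ge2$, $n\ge k+2$, $p=k+1$ and $q=n-k-1$. Let $(\mathsf u_{i,j})$, $0\le i\le k$, $1\le j\le q$, be real numbers with $\sum_{i=0}^{p-1}\mathsf u_{i,j}=0$ for each $j\in\{1,\ldots,q\}$ and with $\mathsf u_{i,j}>0$ for $0\le i\le k-1$. Define the tropical scattering potential, for $x=(x_{i,j})\in\mathbb R^{(p-2)q}$ ($1\le i\le p-2=k-1$, $1\le j\le q$), by $$ F^{(k)}_{p,q}(x)=\sum_{j=1}^{q}\Bigl[\sum_{i=1}^{p-2}\mathsf u_{i,j}\,x_{i,j}+\mathsf u_{k,j}\cdot\min(0,x_{1,j},x_{2,j},\ldots,x_{k-1,j})\Bigr]. $$ Then $$ I_{p,q}:=\int_{\mathbb R^{(p-2)q}}\exp\bigl(-F^{(k)}_{p,q}(x)\bigr)\,d^{(p-2)q}x\;=\;\prod_{j=1}^{q}\left(\frac{\sum_{i=0}^{p-2}\mathsf u_{i,j}}{\prod_{i=0}^{p-2}\mathsf u_{i,j}}\right). $$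
   Context: The integral is a Lebesgue integral over $\mathbb R^{(p-2)q}$. The function $F^{(k)}_{p,q}$ is $\sum_{i,j}\mathsf u_{i-1,j}\,\mathcal X^{\rm trop}_{i,j}$, where $\mathcal X^{\rm trop}_{i,j}$ ($1\le i\le p$, $1\le j\le q$) are the min-plus tropicalizations of the entries of the $p\times q$ matrix whose $j$-th column is $(1,x_{1,j},\ldots,x_{k-1,j},1+\sum_{i=1}^{k-1}x_{i,j})^T$. *)

theory Defs
  imports "HOL-Analysis.Analysis"
begin

text \<open>
  A point of \<open>\<real>\<^bsup>(p-2)q\<^esup>\<close> is a function on the finite index set
  \<open>{1..p-2} \<times> {1..q}\<close>, its \<open>(i,j)\<close> coordinate being \<open>x (i, j)\<close>. Since \<open>p\<close> and \<open>q\<close> are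
  numbers rather than types, Lebesgue measure is the finite product of copies of \<^const>\<open>lborel\<close>
  (its restriction to Borel sets, which does not affect integrals of Borel functions).
\<close>

definition coord_indices :: "nat \<Rightarrow> nat \<Rightarrow> (nat \<times> nat) set" where
  "coord_indices p q = {1..p - 2} \<times> {1..q}"

definition lebesgue_coords :: "nat \<Rightarrow> nat \<Rightarrow> (nat \<times> nat \<Rightarrow> real) measure" where
  "lebesgue_coords p q = (\<Pi>\<^sub>M ij\<in>coord_indices p q. lborel)"

definition trop_potential ::
  "nat \<Rightarrow> nat \<Rightarrow> nat \<Rightarrow> (nat \<Rightarrow> nat \<Rightarrow> real) \<Rightarrow> (nat \<times> nat \<Rightarrow> real) \<Rightarrow> real" where
  "trop_potential k p q u x =
     (\<Sum>j=1..q. (\<Sum>i=1..p - 2. u i j * x (i, j)) +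
        u k j * Min (insert 0 ((\<lambda>i. x (i, j)) ` {1..k - 1})))"

definition trop_integral :: "nat \<Rightarrow> nat \<Rightarrow> nat \<Rightarrow> (nat \<Rightarrow> nat \<Rightarrow> real) \<Rightarrow> real" where
  "trop_integral k p q u =
     (\<integral>x. exp (- trop_potential k p q u x) \<partial>lebesgue_coords p q)"

end

(*
  For one column with S = u_0 + ... + u_{k-1} > 0, the minimum is linearized by
    exp (S * min(0, x_1, ..., x_{k-1})) = integral of S * exp (S * t) over all t \<le> min(0, x_1, ..., x_{k-1}).
  The constraint on t decouples into t \<le> 0 and t \<le> x_i, so after exchanging the order of integration
  the x_i-integrals are one-dimensional exponential tails exp (- u_i * t) / u_i, and the remaining integrand
  is proportional to exp (u_0 * t) on t \<le> 0. All columns are treated at once, with one auxiliary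
  variable t_j per column.
*)
theory Submission
  imports Defs
begin

lemma nn_integral_exp_right_tail:
  fixes c t :: real
  assumes "c > 0"
  shows "(\<integral>\<^sup>+x. ennreal (if t \<le> x then exp (- (c * x)) else 0) \<partial>lborel) = ennreal (exp (- (c * t)) / c)"
proof -
  have "(\<integral>\<^sup>+x. ennreal (exp (- (c * x))) * indicator {t..} x \<partial>lborel)
      = ennreal (0 - (- exp (- (c * t)) / c))"
  proof (rule nn_integral_FTC_atLeast)
    show "((\<lambda>x. - exp (- (c * x)) / c) has_real_derivative exp (- (c * x))) (at x)" for x
      using assms by (auto intro!: derivative_eq_intros)
    have "filterlim (\<lambda>x. c * x) at_top at_top"
      using assms by (intro filterlim_tendsto_pos_mult_at_top[OF tendsto_const]) (auto simp: filterlim_ident)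
    then have "((\<lambda>x. exp (- (c * x))) \<longlongrightarrow> 0) at_top"
      by (intro filterlim_compose[OF exp_at_bot]) (simp add: filterlim_uminus_at_top)
    then have "((\<lambda>x. - (exp (- (c * x)) / c)) \<longlongrightarrow> - (0 / c)) at_top"
      using assms by (intro tendsto_intros) auto
    then show "((\<lambda>x. - exp (- (c * x)) / c) \<longlongrightarrow> 0) at_top"
      by simp
  qed auto
  also have "(\<lambda>x. ennreal (exp (- (c * x))) * indicator {t..} x)
      = (\<lambda>x. ennreal (if t \<le> x then exp (- (c * x)) else 0))"
    by (auto simp: indicator_def)
  finally show ?thesis by simp
qed

lemma nn_integral_exp_left_tail:
  fixes c b :: real
  assumes "c > 0"
  shows "(\<integral>\<^sup>+x. ennreal (if x \<le> b then exp (c * x) else 0) \<partial>lborel) = ennreal (exp (c * b) / c)"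
proof -
  have "(\<integral>\<^sup>+x. ennreal (if x \<le> b then exp (c * x) else 0) \<partial>lborel)
      = (\<integral>\<^sup>+x. ennreal (if - b \<le> x then exp (- (c * x)) else 0) \<partial>lborel)"
    \<comment> \<open>Replacing x by -x reflects the tail below \<open>b\<close> into the tail above
      \<open>- b\<close>.\<close>
    by (subst nn_integral_real_affine[where c = "-1" and t = 0])
       (auto intro!: nn_integral_cong simp: if_distrib neg_le_iff_le minus_le_iff)
  then show ?thesis
    using nn_integral_exp_right_tail[OF assms, of "- b"] by simp
qed

text \<open>The zero-sum relation is solved in advance: \<open>a j\<close> stands for the
  coefficient with row index 0, \<open>c i j\<close> for the other positive ones and
  \<open>- S j\<close> for the last. Positivity of \<open>a\<close> and \<open>c\<close> then
  carries everything. Both conclusions come from one computation with nonnegative integrals, so no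
  integrability has to be known beforehand.\<close>

lemma trop_integral_product:
  fixes a :: "'b \<Rightarrow> real" and c :: "'a \<Rightarrow> 'b \<Rightarrow> real"
  assumes fin: "finite I" "finite J"
    and a: "\<And>j. j \<in> J \<Longrightarrow> a j > 0"
    and c: "\<And>i j. i \<in> I \<Longrightarrow> j \<in> J \<Longrightarrow> c i j > 0"
  defines "S \<equiv> \<lambda>j. a j + (\<Sum>i\<in>I. c i j)"
  defines "F \<equiv> \<lambda>x. \<Sum>j\<in>J. (\<Sum>i\<in>I. c i j * x (i, j)) - S j * Min (insert 0 ((\<lambda>i. x (i, j)) ` I))"
  defines "M \<equiv> \<Pi>\<^sub>M ij\<in>I \<times> J. (lborel :: real measure)"
  shows "integrable M (\<lambda>x. exp (- F x))"
    and "(\<integral>x. exp (- F x) \<partial>M) = (\<Prod>j\<in>J. S j / (a j * (\<Prod>i\<in>I. c i j)))"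
proof -
  interpret X: product_sigma_finite "\<lambda>_ :: 'a \<times> 'b. lborel :: real measure" ..
  interpret T: product_sigma_finite "\<lambda>_ :: 'b. lborel :: real measure" ..
  define N where "N = (\<Pi>\<^sub>M j\<in>J. (lborel :: real measure))"
  interpret N: sigma_finite_measure N
    unfolding N_def using fin by (intro T.sigma_finite)
  interpret M: sigma_finite_measure M
    unfolding M_def using fin by (intro X.sigma_finite) auto
  interpret NM: pair_sigma_finite M N ..
  \<comment> \<open>The cutoffs \<open>t \<le> 0\<close> and \<open>t \<le> x\<close> are built into
    separate factors, so that \<open>H\<close> splits over columns when x is fixed and over all
    coordinates when t is fixed.\<close>
  define g where "g j t = ennreal (if t \<le> 0 then S j * exp (S j * t) else 0)" for j and t :: real
  define h where "h i j t x = ennreal (if t \<le> x then exp (- (c i j * x)) else 0)" for i j and t x :: real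
  define H where "H x t = (\<Prod>j\<in>J. g j (t j) * (\<Prod>i\<in>I. h i j (t j) (x (i, j))))" for t x
  have S: "S j > 0" if "j \<in> J" for j
    unfolding S_def using that a c by (intro add_pos_nonneg sum_nonneg) (auto intro: less_imp_le)
  have [measurable]: "(\<lambda>t. g j t) \<in> borel_measurable borel" for j
    unfolding g_def by measurable
  \<comment> \<open>Stated for arbitrary measurable arguments, since \<open>h\<close> is used
    jointly in (x, t), in x alone and in t alone.\<close>
  have h_meas: "(\<lambda>z. h i j (f z) (f' z)) \<in> borel_measurable L"
    if [measurable]: "f \<in> borel_measurable L" "f' \<in> borel_measurable L" for i j f f' and L :: "'z measure"
    unfolding h_def by measurable
  have H_meas: "case_prod H \<in> borel_measurable (M \<Otimes>\<^sub>M N)"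
    unfolding H_def case_prod_beta M_def N_def
    by (intro borel_measurable_prod_ennreal borel_measurable_times_ennreal h_meas) measurable
  have exp_F: "ennreal (exp (- F x)) = (\<integral>\<^sup>+t. H x t \<partial>N)" for x
  proof -
    have col: "(\<integral>\<^sup>+s. g j s * (\<Prod>i\<in>I. h i j s (x (i, j))) \<partial>lborel)
        = ennreal (exp (- ((\<Sum>i\<in>I. c i j * x (i, j)) - S j * Min (insert 0 ((\<lambda>i. x (i, j)) ` I)))))"
      (is "?L = ennreal (exp (- (?s - S j * ?m)))") if j: "j \<in> J" for j
    proof -
      \<comment> \<open>The cutoffs of one column multiply to the single cutoff
        \<open>s \<le> ?m\<close>; if it fails, some factor vanishes.\<close>
      have "g j s * (\<Prod>i\<in>I. h i j s (x (i, j)))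
          = ennreal (S j * exp (- ?s)) * ennreal (if s \<le> ?m then exp (S j * s) else 0)" for s
      proof (cases "s \<le> ?m")
        case True
        then have "s \<le> 0" "\<And>i. i \<in> I \<Longrightarrow> s \<le> x (i, j)"
          using fin by auto
        then show ?thesis
          using True S[OF j] fin
          by (simp add: g_def h_def prod_ennreal exp_sum[symmetric] sum_negf ennreal_mult'[symmetric] mult_ac)
      next
        case False
        then have "\<not> s \<le> 0 \<or> (\<exists>i\<in>I. \<not> s \<le> x (i, j))"
          using fin by auto
        then have "g j s = 0 \<or> (\<Prod>i\<in>I. h i j s (x (i, j))) = 0"
          using fin by (auto simp: g_def h_def prod_zero_iff)
        with False show ?thesis by auto
      qed
      \<comment> \<open>The normalizing factor \<open>S j\<close> in \<open>g\<close> cancels the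
        denominator of the left tail.\<close>
      then have "?L = ennreal (S j * exp (- ?s)) * ennreal (exp (S j * ?m) / S j)"
        using nn_integral_exp_left_tail[OF S[OF j]] by (simp add: nn_integral_cmult)
      also have "\<dots> = ennreal (exp (- (?s - S j * ?m)))"
        using S[OF j] by (simp add: ennreal_mult'[symmetric] exp_diff exp_minus field_simps)
      finally show ?thesis .
    qed
    have "(\<integral>\<^sup>+t. H x t \<partial>N) = (\<Prod>j\<in>J. \<integral>\<^sup>+s. g j s * (\<Prod>i\<in>I. h i j s (x (i, j))) \<partial>lborel)"
      unfolding H_def N_def using fin
      by (intro T.product_nn_integral_prod borel_measurable_prod_ennreal borel_measurable_times_ennreal h_meas) measurable
    also have "\<dots> = ennreal (exp (- F x))"
      using fin by (simp add: col prod_ennreal exp_sum[symmetric] F_def sum_negf[symmetric] cong: prod.cong)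
    finally show ?thesis ..
  qed
  have meas: "(\<lambda>x. exp (- F x)) \<in> borel_measurable M"
  proof -
    \<comment> \<open>Measurability is read off from the parameter integral, which avoids arguing
      about \<open>Min\<close> directly.\<close>
    have "(\<lambda>x. enn2real (\<integral>\<^sup>+t. H x t \<partial>N)) \<in> borel_measurable M"
      using N.borel_measurable_nn_integral[OF H_meas] by measurable
    then show ?thesis
      by (simp add: exp_F[symmetric])
  qed
  have inner: "(\<integral>\<^sup>+x. H x t \<partial>M)
      = (\<Prod>j\<in>J. ennreal (S j / (\<Prod>i\<in>I. c i j)) * ennreal (if t j \<le> 0 then exp (a j * t j) else 0))" for t
  proof -
    have "(\<integral>\<^sup>+x. H x t \<partial>M) = (\<integral>\<^sup>+x. (\<Prod>j\<in>J. g j (t j)) * (\<Prod>(i, j)\<in>I \<times> J. h i j (t j) (x (i, j))) \<partial>M)"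
      \<comment> \<open>The \<open>g\<close> factors do not involve x and come out; the
        \<open>h\<close> factors regroup into one factor per coordinate of x.\<close>
      unfolding H_def prod.distrib by (subst prod.swap) (simp add: prod.cartesian_product)
    also have "\<dots> = (\<Prod>j\<in>J. g j (t j)) * (\<integral>\<^sup>+x. (\<Prod>ij\<in>I \<times> J. h (fst ij) (snd ij) (t (snd ij)) (x ij)) \<partial>M)"
      unfolding M_def case_prod_beta prod.collapse
      by (intro nn_integral_cmult borel_measurable_prod_ennreal h_meas) measurable
    also have "(\<integral>\<^sup>+x. (\<Prod>ij\<in>I \<times> J. h (fst ij) (snd ij) (t (snd ij)) (x ij)) \<partial>M)
        = (\<Prod>ij\<in>I \<times> J. \<integral>\<^sup>+y. h (fst ij) (snd ij) (t (snd ij)) y \<partial>lborel)"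
      unfolding M_def using fin
      by (intro X.product_nn_integral_prod h_meas) auto
    also have "\<dots> = (\<Prod>ij\<in>I \<times> J. ennreal (exp (- (c (fst ij) (snd ij) * t (snd ij))) / c (fst ij) (snd ij)))"
      unfolding h_def using c by (intro prod.cong refl nn_integral_exp_right_tail) auto
    also have "\<dots> = (\<Prod>j\<in>J. \<Prod>i\<in>I. ennreal (exp (- (c i j * t j)) / c i j))"
      by (subst prod.swap) (simp add: prod.cartesian_product case_prod_beta)
    also have "(\<Prod>j\<in>J. g j (t j)) * \<dots> = (\<Prod>j\<in>J. g j (t j) * (\<Prod>i\<in>I. ennreal (exp (- (c i j * t j)) / c i j)))"
      by (simp add: prod.distrib)
    also have "\<dots> = (\<Prod>j\<in>J. ennreal (S j / (\<Prod>i\<in>I. c i j)) * ennreal (if t j \<le> 0 then exp (a j * t j) else 0))"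
    proof (rule prod.cong[OF refl])
      fix j assume j: "j \<in> J"
      have P: "(\<Prod>i\<in>I. c i j) > 0" using c j by (intro prod_pos) auto
      have "(\<Prod>i\<in>I. ennreal (exp (- (c i j * t j)) / c i j)) = ennreal (\<Prod>i\<in>I. exp (- (c i j * t j)) / c i j)"
        using c j by (intro prod_ennreal) (auto intro: less_imp_le)
      also have "(\<Prod>i\<in>I. exp (- (c i j * t j)) / c i j) = exp (- ((\<Sum>i\<in>I. c i j) * t j)) / (\<Prod>i\<in>I. c i j)"
        using fin by (simp add: prod_dividef exp_sum[symmetric] sum_negf sum_distrib_right)
      finally have prod_c: "(\<Prod>i\<in>I. ennreal (exp (- (c i j * t j)) / c i j))
          = ennreal (exp (- ((\<Sum>i\<in>I. c i j) * t j)) / (\<Prod>i\<in>I. c i j))" .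
      \<comment> \<open>Here \<open>S j\<close> minus the sum of the \<open>c i j\<close> leaves
        exactly the rate \<open>a j\<close>, whose positivity makes the remaining integral over
        \<open>t j \<le> 0\<close> finite.\<close>
      have "exp (S j * t j) * exp (- ((\<Sum>i\<in>I. c i j) * t j)) = exp (a j * t j)"
        by (simp add: S_def exp_add[symmetric] algebra_simps)
      then have "S j * exp (S j * t j) * (exp (- ((\<Sum>i\<in>I. c i j) * t j)) / (\<Prod>i\<in>I. c i j))
          = S j / (\<Prod>i\<in>I. c i j) * exp (a j * t j)"
        by (metis (no_types) mult.assoc times_divide_eq_left times_divide_eq_right)
      then show "g j (t j) * (\<Prod>i\<in>I. ennreal (exp (- (c i j * t j)) / c i j))
          = ennreal (S j / (\<Prod>i\<in>I. c i j)) * ennreal (if t j \<le> 0 then exp (a j * t j) else 0)"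
        using S[OF j] P unfolding prod_c by (simp add: g_def ennreal_mult'[symmetric])
    qed
    finally show ?thesis .
  qed
  have val: "(\<integral>\<^sup>+x. ennreal (exp (- F x)) \<partial>M) = ennreal (\<Prod>j\<in>J. S j / (a j * (\<Prod>i\<in>I. c i j)))"
  proof -
    have P: "(\<Prod>i\<in>I. c i j) > 0" if "j \<in> J" for j using c that by (intro prod_pos) auto
    \<comment> \<open>Tonelli: the joint measurability of \<open>H\<close> suffices for the
      exchange.\<close>
    have "(\<integral>\<^sup>+x. ennreal (exp (- F x)) \<partial>M) = (\<integral>\<^sup>+t. (\<integral>\<^sup>+x. H x t \<partial>M) \<partial>N)"
      unfolding exp_F using H_meas by (rule NM.Fubini'[symmetric])
    also have "\<dots> = (\<Prod>j\<in>J. \<integral>\<^sup>+s. ennreal (S j / (\<Prod>i\<in>I. c i j)) * ennreal (if s \<le> 0 then exp (a j * s) else 0) \<partial>lborel)"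
      unfolding inner N_def using fin by (intro T.product_nn_integral_prod) auto
    also have "\<dots> = (\<Prod>j\<in>J. ennreal (S j / (a j * (\<Prod>i\<in>I. c i j))))"
    proof (rule prod.cong[OF refl])
      fix j assume j: "j \<in> J"
      show "(\<integral>\<^sup>+s. ennreal (S j / (\<Prod>i\<in>I. c i j)) * ennreal (if s \<le> 0 then exp (a j * s) else 0) \<partial>lborel)
          = ennreal (S j / (a j * (\<Prod>i\<in>I. c i j)))"
        \<comment> \<open>The left tail ends at 0, so it contributes \<open>1 / a j\<close>.\<close>
        using nn_integral_exp_left_tail[OF a[OF j], of 0] S[OF j] P[OF j] a[OF j]
        by (subst nn_integral_cmult) (auto simp: ennreal_mult'[symmetric] mult_ac)
    qed
    also have "\<dots> = ennreal (\<Prod>j\<in>J. S j / (a j * (\<Prod>i\<in>I. c i j)))"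
      using S P a by (intro prod_ennreal) (auto intro!: divide_nonneg_nonneg mult_nonneg_nonneg less_imp_le)
    finally show ?thesis .
  qed
  have nonneg: "(\<Prod>j\<in>J. S j / (a j * (\<Prod>i\<in>I. c i j))) \<ge> 0"
    using S a c by (intro prod_nonneg ballI divide_nonneg_nonneg mult_nonneg_nonneg) (auto intro: less_imp_le)
  show "integrable M (\<lambda>x. exp (- F x))"
    and "(\<integral>x. exp (- F x) \<partial>M) = (\<Prod>j\<in>J. S j / (a j * (\<Prod>i\<in>I. c i j)))"
    \<comment> \<open>For a nonnegative function, a finite nonnegative integral gives integrability
      and the value together.\<close>
    using nn_integral_eq_integrable[OF meas _ nonneg] val by auto
qed

theorem mainTheorem5:
  fixes k n p q :: nat and u :: "nat \<Rightarrow> nat \<Rightarrow> real"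
  assumes "k \<ge> 2" and "n \<ge> k + 2" and "p = k + 1" and "q = n - k - 1"
    and "\<And>j. j \<in> {1..q} \<Longrightarrow> (\<Sum>i=0..p - 1. u i j) = 0"
    and "\<And>i j. i \<in> {0..k - 1} \<Longrightarrow> j \<in> {1..q} \<Longrightarrow> u i j > 0"
  shows "integrable (lebesgue_coords p q) (\<lambda>x. exp (- trop_potential k p q u x)) \<and>
    trop_integral k p q u =
      (\<Prod>j=1..q. (\<Sum>i=0..p - 2. u i j) / (\<Prod>i=0..p - 2. u i j))"
proof -
  have p2: "p - 2 = k - 1" using assms by simp
  \<comment> \<open>Row 0 is split off because it has no coordinate of x: \<open>u 0 j\<close> takes
    the role of \<open>a j\<close>, and its factor in the product becomes the \<open>a j\<close> in
    the denominator.\<close>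
  have split: "{0..k - 1} = insert 0 {1..k - 1}" by auto
  \<comment> \<open>The vanishing column sum identifies \<open>u k j\<close> with
    \<open>- S j\<close>, the negative coefficient of the minimum.\<close>
  have last: "u k j = - (u 0 j + (\<Sum>i=1..k - 1. u i j))" if "j \<in> {1..q}" for j
  proof -
    have "{0..p - 1} = insert k (insert 0 {1..k - 1})" using assms(1,3) by auto
    then show ?thesis using assms(1) assms(5)[OF that] by simp
  qed
  have pot: "trop_potential k p q u x = (\<Sum>j=1..q. (\<Sum>i=1..k - 1. u i j * x (i, j))
      - (u 0 j + (\<Sum>i=1..k - 1. u i j)) * Min (insert 0 ((\<lambda>i. x (i, j)) ` {1..k - 1})))" for x
    unfolding trop_potential_def p2 by (intro sum.cong refl) (simp add: last algebra_simps)
  have pos: "\<And>j. j \<in> {1..q} \<Longrightarrow> u 0 j > 0" "\<And>i j. i \<in> {1..k - 1} \<Longrightarrow> j \<in> {1..q} \<Longrightarrow> u i j > 0"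
    using assms(6) by auto
  show ?thesis
    using trop_integral_product[of "{1..k - 1}" "{1..q}" "u 0" u, OF _ _ pos]
    unfolding trop_integral_def lebesgue_coords_def coord_indices_def pot p2 split by simp
qed

end
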